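(* Let $(V,\Diamond)$ be a complex modal $K4$ algebra. Then $(V,\Diamond)$ is locally finite if and only if it does not contain an infinite descending $\Diamond$-tower.
   Context: For a Kripke frame $F=(X,R)$ (a set $X$ with a binary relation $R$), the complex algebra of $F$ is the modal algebra $A(F)=(\mathcal{P}(X),\Diamond_R)$, where $\Diamond_R U=R^{-1}[U]=\{x\in X\mid \exists u\in U\ (xRu)\}$. A complex modal $K4$ algebra is the complex algebra of a Kripke frame that satisfies $\Diamond\Diamond U\subseteq\Diamond U$ for all $U$ (equivalently, the complex algebra of a transitive Kripke frame). An algebra is locally finite if each of its finitely generated subalgebras is finite (subalgebras here are closed under the Boolean operations and $\Diamond$). A modal algebra $(V,\Diamond)$ of sets contains an infinite descending $\Diamond$-tower if there are nonempty, pairwise disjoint elements $T_1,T_2,T_3,\dots\in V$ such that for all $i\geq 1$: (i) $T_{i+1}\subseteq\Diamond T_i$; (ii) $T_i\cap\Diamond T_{i+1}=\emptyset$. *)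

theory Defs
  imports "HOL-Analysis.Sigma_Algebra"
begin

text \<open>
  A modal algebra of sets is given by its top element \<open>X\<close>, its family of elements \<open>V\<close> and its
  modal operator \<open>D\<close>.  The operator is a total function on sets, so every notion below uses
  only its values on elements of \<open>V\<close>.
\<close>

definition frame_diamond :: "('a \<times> 'a) set \<Rightarrow> 'a set \<Rightarrow> 'a set" where
  "frame_diamond R U = R\<inverse> `` U"

definition complex_algebra_of ::
    "'a set \<Rightarrow> ('a \<times> 'a) set \<Rightarrow> 'a set set \<Rightarrow> ('a set \<Rightarrow> 'a set) \<Rightarrow> bool" where
  "complex_algebra_of X R V D \<longleftrightarrow> V = Pow X \<and> (\<forall>U\<in>V. D U = frame_diamond R U)"

definition complex_K4_algebra ::
    "'a set \<Rightarrow> 'a set set \<Rightarrow> ('a set \<Rightarrow> 'a set) \<Rightarrow> bool" where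
  "complex_K4_algebra X V D \<longleftrightarrow>
     (\<exists>R. R \<subseteq> X \<times> X \<and> complex_algebra_of X R V D) \<and> (\<forall>U\<in>V. D (D U) \<subseteq> D U)"

definition modal_subalgebra ::
    "'a set \<Rightarrow> 'a set set \<Rightarrow> ('a set \<Rightarrow> 'a set) \<Rightarrow> 'a set set \<Rightarrow> bool" where
  "modal_subalgebra X V D A \<longleftrightarrow> A \<subseteq> V \<and> algebra X A \<and> (\<forall>U\<in>A. D U \<in> A)"

definition finitely_generated_subalgebra ::
    "'a set \<Rightarrow> 'a set set \<Rightarrow> ('a set \<Rightarrow> 'a set) \<Rightarrow> 'a set set \<Rightarrow> bool" where
  "finitely_generated_subalgebra X V D A \<longleftrightarrow>
     (\<exists>G. finite G \<and> G \<subseteq> V \<and> A = modal_subalgebra X V D hull G)"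

definition locally_finite_algebra ::
    "'a set \<Rightarrow> 'a set set \<Rightarrow> ('a set \<Rightarrow> 'a set) \<Rightarrow> bool" where
  "locally_finite_algebra X V D \<longleftrightarrow>
     (\<forall>A. finitely_generated_subalgebra X V D A \<longrightarrow> finite A)"

definition has_infinite_descending_tower ::
    "'a set set \<Rightarrow> ('a set \<Rightarrow> 'a set) \<Rightarrow> bool" where
  "has_infinite_descending_tower V D \<longleftrightarrow>
     (\<exists>T :: nat \<Rightarrow> 'a set.
        (\<forall>i\<ge>1. T i \<in> V \<and> T i \<noteq> {}) \<and>
        disjoint_family_on T {1..} \<and>
        (\<forall>i\<ge>1. T (i + 1) \<subseteq> D (T i) \<and> T i \<inter> D (T (i + 1)) = {}))"

text \<open>
  The hull in \<open>finitely_generated_subalgebra\<close> is an intersection of a nonempty family and is itself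
  a subalgebra; the inequality in \<open>complex_K4_algebra\<close> is transitivity of the accessibility relation.
\<close>

lemma frame_diamond_iff: "x \<in> frame_diamond R U \<longleftrightarrow> (\<exists>u\<in>U. (x, u) \<in> R)"
  by (auto simp: frame_diamond_def)

lemma modal_subalgebra_self:
  assumes "R \<subseteq> X \<times> X" "complex_algebra_of X R V D"
  shows "modal_subalgebra X V D V"
  using assms
  by (auto simp: modal_subalgebra_def complex_algebra_of_def frame_diamond_def algebra_Pow)

lemma modal_subalgebra_hull:
  assumes "modal_subalgebra X V D V" "G \<subseteq> V"
  shows "modal_subalgebra X V D (modal_subalgebra X V D hull G)"
proof -
  have *: "modal_subalgebra X V D (\<Inter>\<A>)"
    if ne: "\<A> \<noteq> {}" and sub: "\<And>A. A \<in> \<A> \<Longrightarrow> modal_subalgebra X V D A" for \<A>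
  proof -
    obtain A\<^sub>0 where "A\<^sub>0 \<in> \<A>" using ne by blast
    then have "\<Inter>\<A> \<subseteq> V" "\<Inter>\<A> \<subseteq> Pow X"
      using sub[of A\<^sub>0] by (auto simp: modal_subalgebra_def algebra_iff_Un)
    moreover have "{} \<in> A" "\<And>a. a \<in> A \<Longrightarrow> X - a \<in> A" "\<And>a. a \<in> A \<Longrightarrow> D a \<in> A"
        "\<And>a b. a \<in> A \<Longrightarrow> b \<in> A \<Longrightarrow> a \<union> b \<in> A" if "A \<in> \<A>" for A
      using sub[OF that]
      unfolding modal_subalgebra_def algebra_iff_Un by blast+
    ultimately show ?thesis
      unfolding modal_subalgebra_def algebra_iff_Un by (intro conjI ballI InterI) auto
  qed
  show ?thesis
    unfolding hull_def by (rule *) (use assms in auto)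
qed

lemma complex_K4_algebra_iff_trans:
  "complex_K4_algebra X V D \<longleftrightarrow>
     (\<exists>R. R \<subseteq> X \<times> X \<and> trans R \<and> complex_algebra_of X R V D)"
proof -
  have "(\<forall>U\<in>V. D (D U) \<subseteq> D U) \<longleftrightarrow> trans R"
    if R: "R \<subseteq> X \<times> X" and V: "complex_algebra_of X R V D" for R
  proof -
    have in_X: "frame_diamond R U \<subseteq> X" for U
      using R by (auto simp: frame_diamond_def)
    have "(\<forall>U\<in>V. D (D U) \<subseteq> D U) \<longleftrightarrow>
          (\<forall>U\<in>Pow X. frame_diamond R (frame_diamond R U) \<subseteq> frame_diamond R U)"
      using V in_X by (auto simp: complex_algebra_of_def)
    also have "\<dots> \<longleftrightarrow> trans R"
    proof
      assume K4: "\<forall>U\<in>Pow X. frame_diamond R (frame_diamond R U) \<subseteq> frame_diamond R U"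
      show "trans R"
      proof (rule transI)
        fix x y z assume xy: "(x, y) \<in> R" "(y, z) \<in> R"
        then have "x \<in> frame_diamond R (frame_diamond R {z})" "{z} \<in> Pow X"
          using R by (auto simp: frame_diamond_def)
        with K4 have "x \<in> frame_diamond R {z}" by blast
        then show "(x, z) \<in> R" by (simp add: frame_diamond_iff)
      qed
    next
      assume "trans R"
      then show "\<forall>U\<in>Pow X. frame_diamond R (frame_diamond R U) \<subseteq> frame_diamond R U"
        by (auto simp: frame_diamond_def dest: transD)
    qed
    finally show ?thesis .
  qed
  then show ?thesis
    unfolding complex_K4_algebra_def by blast
qed

end

(*
  Locally finite implies no tower: the unions of the even and of the odd levels of a tower generate
  every level, since the n-th level consists of the points of its parity that remain after
  removal of the earlier levels and see no remaining point of the other parity.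

  No tower implies locally finite: peel off X from the top.  If Z is an R-closed set with a finite
  colouring that is stable under bisimulation, colour each remaining point x by its generators and
  by the colours that it sees in Z.  The remaining points such that every remaining successor sees
  the same new colours form the next level L: finitely many types of points occur in it, and every
  point outside of Z and L sees L because a finite set of colours cannot shrink forever.  If the
  process does not stop, the levels form a tower.  If it stops, then X has a finite stable
  colouring, and the sets that are unions of colours form a finite subalgebra.
*)
theory Submission
  imports Defs
begin

section \<open>Finite stable colourings of closed sets\<close>

text \<open>The kernel of \<open>f\<close> on the generated subframe \<open>Z\<close> is a
  bisimulation equivalence of finite index that respects the generators.\<close>

definition tuned :: "('a \<times> 'a) set \<Rightarrow> 'a set set \<Rightarrow> 'a set \<Rightarrow> ('a \<Rightarrow> 'b) \<Rightarrow> bool" where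
  "tuned R G Z f \<longleftrightarrow> R `` Z \<subseteq> Z \<and> finite (f ` Z) \<and>
     (\<forall>x\<in>Z. \<forall>y\<in>Z. f x = f y \<longrightarrow>
        {U\<in>G. x \<in> U} = {U\<in>G. y \<in> U} \<and> f ` (R `` {x}) = f ` (R `` {y}))"

lemma tunedI:
  assumes "R `` Z \<subseteq> Z" "finite (f ` Z)"
    and "\<And>x y. \<lbrakk>x \<in> Z; y \<in> Z; f x = f y\<rbrakk> \<Longrightarrow> {U\<in>G. x \<in> U} = {U\<in>G. y \<in> U}"
    and "\<And>x y. \<lbrakk>x \<in> Z; y \<in> Z; f x = f y\<rbrakk> \<Longrightarrow> f ` (R `` {x}) = f ` (R `` {y})"
  shows "tuned R G Z f"
  unfolding tuned_def by (intro conjI ballI impI assms)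

lemma tunedD:
  assumes "tuned R G Z f"
  shows "R `` Z \<subseteq> Z" "finite (f ` Z)"
    and "\<lbrakk>x \<in> Z; y \<in> Z; f x = f y\<rbrakk> \<Longrightarrow> {U\<in>G. x \<in> U} = {U\<in>G. y \<in> U}"
    and "\<lbrakk>x \<in> Z; y \<in> Z; f x = f y\<rbrakk> \<Longrightarrow> f ` (R `` {x}) = f ` (R `` {y})"
  using assms unfolding tuned_def by blast+

text \<open>The step in \<open>tuned_extend\<close> enlarges the type of colours; recoding them as numbers lets it be
  iterated.\<close>

lemma tuned_to_nat:
  fixes f :: "'a \<Rightarrow> 'b"
  assumes "tuned R G Z f"
  shows "\<exists>g :: 'a \<Rightarrow> nat. tuned R G Z g"
proof -
  obtain e :: "'b \<Rightarrow> nat" where e: "inj_on e (f ` Z)"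
    using finite_imp_inj_to_nat_seg[OF tunedD(2)[OF assms]] by metis
  have f_eq: "f x = f y" if "x \<in> Z" "y \<in> Z" "(e \<circ> f) x = (e \<circ> f) y" for x y
    by (rule inj_onD[OF e]) (use that in simp_all)
  have "tuned R G Z (e \<circ> f)"
  proof (rule tunedI)
    fix x y assume xy: "x \<in> Z" "y \<in> Z" "(e \<circ> f) x = (e \<circ> f) y"
    show "{U\<in>G. x \<in> U} = {U\<in>G. y \<in> U}"
      by (rule tunedD(3)[OF assms xy(1,2) f_eq[OF xy]])
    show "(e \<circ> f) ` (R `` {x}) = (e \<circ> f) ` (R `` {y})"
      unfolding image_comp[symmetric] tunedD(4)[OF assms xy(1,2) f_eq[OF xy]] ..
  next
    show "finite ((e \<circ> f) ` Z)"
      unfolding image_comp[symmetric] by (rule finite_imageI[OF tunedD(2)[OF assms]])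
  qed (rule tunedD(1)[OF assms])
  then show ?thesis by blast
qed

text \<open>Transitivity makes the set \<open>s x\<close> of types seen outside \<open>Z\<close>
  shrink along \<open>R\<close>, and finiteness of the set of types makes it reach a constant value.
  Where it is constant, the pair \<open>(c x, s x)\<close> determines the colours of all
  successors.\<close>

lemma tuned_extend:
  fixes f :: "'a \<Rightarrow> nat"
  assumes R: "R \<subseteq> X \<times> X" "trans R" and G: "finite G" and Z: "Z \<subseteq> X" "tuned R G Z f"
  obtains L and g :: "'a \<Rightarrow> nat"
  where "L \<subseteq> X - Z" "tuned R G (Z \<union> L) g" "X - (Z \<union> L) \<subseteq> R\<inverse> `` L"
proof -
  define c where "c x = ({U\<in>G. x \<in> U}, f ` (R `` {x} \<inter> Z))" for x
  define s where "s x = c ` (R `` {x} - Z)" for x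
  define L where "L = {x\<in>X - Z. \<forall>y\<in>R `` {x} - Z. s y = s x}"
  \<comment> \<open>The two injections keep new colours apart from old ones, so points of equal
    colour lie both in \<open>Z\<close> or both outside it.\<close>
  define h where "h x = (if x \<in> Z then Inl (f x) else Inr (c x, s x))" for x
  have Zc: "R `` Z \<subseteq> Z" and finf: "finite (f ` Z)" using tunedD[OF Z(2)] by blast+
  have s_mono: "s y \<subseteq> s x" if "(x, y) \<in> R" for x y
    using that R(2) unfolding s_def by (auto dest: transD)
  have "range c \<subseteq> Pow G \<times> Pow (f ` Z)" by (auto simp: c_def)
  then have finc: "finite (range c)"
    using G finf by (meson finite_Pow_iff finite_SigmaI finite_subset)
  have fins: "finite (s x)" for x using finc by (rule finite_subset[rotated]) (auto simp: s_def)
  \<comment> \<open>A point outside \<open>L\<close> has a remaining successor with a strictly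
    smaller \<open>s\<close>; induct on its size.\<close>
  have sees: "x \<in> L \<or> x \<in> R\<inverse> `` L" if "x \<in> X - Z" for x
    using that
  proof (induction "card (s x)" arbitrary: x rule: less_induct)
    case less
    show ?case
    proof (cases "x \<in> L")
      case False
      then obtain y where y: "(x, y) \<in> R" "y \<notin> Z" "s y \<noteq> s x"
        using less.prems by (auto simp: L_def)
      then have "card (s y) < card (s x)" "y \<in> X - Z"
        using s_mono[OF y(1)] fins R(1) by (auto intro: psubset_card_mono)
      then have "y \<in> L \<or> y \<in> R\<inverse> `` L" by (rule less.hyps)
      then show ?thesis using y(1) R(2) by (auto dest: transD)
    qed simp
  qed
  \<comment> \<open>Remaining successors of \<open>y\<close> are successors of \<open>x\<close> by
    transitivity, so \<open>y\<close> inherits the constancy of \<open>s\<close> from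
    \<open>x\<close>.\<close>
  have Lc: "y \<in> Z \<union> L" "y \<notin> Z \<Longrightarrow> s y = s x" if "x \<in> L" "(x, y) \<in> R" for x y
  proof -
    show eq: "s y = s x" if "y \<notin> Z" using \<open>x \<in> L\<close> \<open>(x, y) \<in> R\<close> that by (auto simp: L_def)
    have "s z = s x" if "(y, z) \<in> R" "z \<notin> Z" for z
      using \<open>x \<in> L\<close> transD[OF R(2) \<open>(x, y) \<in> R\<close>] that by (auto simp: L_def)
    with eq show "y \<in> Z \<union> L" using R(1) \<open>(x, y) \<in> R\<close> by (auto simp: L_def)
  qed
  \<comment> \<open>The right side mentions \<open>x\<close> only through \<open>c x\<close> and
    \<open>s x\<close>; this is the stability of \<open>h\<close> on \<open>L\<close>.\<close>
  have imgL: "h ` (R `` {x}) = Inl ` snd (c x) \<union> (\<lambda>q. Inr (q, s x)) ` s x" if "x \<in> L" for x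
  proof -
    have "h ` (R `` {x}) = h ` (R `` {x} \<inter> Z) \<union> h ` (R `` {x} - Z)" by blast
    also have "h ` (R `` {x} \<inter> Z) = Inl ` snd (c x)"
      by (force simp: h_def c_def)
    also have "h ` (R `` {x} - Z) = (\<lambda>y. Inr (c y, s x)) ` (R `` {x} - Z)"
      using Lc(2)[OF that] by (intro image_cong) (auto simp: h_def)
    also have "\<dots> = (\<lambda>q. Inr (q, s x)) ` s x" by (simp add: s_def image_image)
    finally show ?thesis .
  qed
  have imgZ: "h ` (R `` {x}) = Inl ` f ` (R `` {x})" if "x \<in> Z" for x
    unfolding image_image using Zc that by (intro image_cong) (auto simp: h_def)
  have "h ` (Z \<union> L) \<subseteq> Inl ` f ` Z \<union> Inr ` (range c \<times> Pow (range c))"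
    by (auto simp: h_def s_def)
  then have fin: "finite (h ` (Z \<union> L))"
    using finf finc
    by (meson finite_Pow_iff finite_SigmaI finite_UnI finite_imageI finite_subset)
  have closed: "R `` (Z \<union> L) \<subseteq> Z \<union> L" using Zc Lc(1) by blast
  have types: "{U\<in>G. x \<in> U} = {U\<in>G. y \<in> U} \<and> h ` (R `` {x}) = h ` (R `` {y})"
    if xy: "x \<in> Z \<union> L" "y \<in> Z \<union> L" and eq: "h x = h y" for x y
  proof (cases "x \<in> Z")
    case True
    then have y: "y \<in> Z" "f x = f y" using eq by (auto simp: h_def split: if_splits)
    show ?thesis
      unfolding imgZ[OF True] imgZ[OF y(1)] tunedD(4)[OF Z(2) True y]
      using tunedD(3)[OF Z(2) True y] by (rule conjI) (rule refl)
  next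
    case False
    then have *: "x \<in> L" "y \<in> L" "c x = c y" "s x = s y"
      using xy eq by (auto simp: h_def split: if_splits)
    from *(3) have "{U\<in>G. x \<in> U} = {U\<in>G. y \<in> U}" unfolding c_def prod.inject by (rule conjunct1)
    moreover have "h ` (R `` {x}) = h ` (R `` {y})"
      unfolding imgL[OF *(1)] imgL[OF *(2)] *(3,4) ..
    ultimately show ?thesis ..
  qed
  have "tuned R G (Z \<union> L) h"
    using closed fin types[THEN conjunct1] types[THEN conjunct2] by (rule tunedI)
  then obtain g :: "'a \<Rightarrow> nat" where "tuned R G (Z \<union> L) g" using tuned_to_nat by blast
  moreover have "L \<subseteq> X - Z" by (auto simp: L_def)
  moreover have "X - (Z \<union> L) \<subseteq> R\<inverse> `` L" using sees by blast
  ultimately show ?thesis using that by blast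
qed

section \<open>From no tower to local finiteness\<close>

text \<open>If \<open>X\<close> has no such colouring, \<open>tuned_extend\<close> can be iterated
  forever from the empty set, and the successive differences are the levels of a tower.\<close>

lemma no_tower_imp_tuned:
  fixes X :: "'a set"
  assumes R: "R \<subseteq> X \<times> X" "trans R" and V: "complex_algebra_of X R V D" and G: "finite G"
    and no: "\<not> has_infinite_descending_tower V D"
  shows "\<exists>f :: 'a \<Rightarrow> nat. tuned R G X f"
proof (rule ccontr)
  assume not_tuned: "\<not> ?thesis"
  define good where "good Z \<longleftrightarrow> Z \<subseteq> X \<and> (\<exists>f :: 'a \<Rightarrow> nat. tuned R G Z f)" for Z
  have good_empty: "good {}" by (simp add: good_def tuned_def)
  have step: "\<exists>Z'. good Z' \<and> Z \<subset> Z' \<and> X - Z' \<subseteq> R\<inverse> `` (Z' - Z)" if good: "good Z" for Z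
  proof -
    obtain f :: "'a \<Rightarrow> nat" where Z: "Z \<subseteq> X" "tuned R G Z f" using good by (auto simp: good_def)
    obtain L and g :: "'a \<Rightarrow> nat"
      where L: "L \<subseteq> X - Z" "tuned R G (Z \<union> L) g" "X - (Z \<union> L) \<subseteq> R\<inverse> `` L"
      using tuned_extend[OF R G Z] .
    have "X \<noteq> Z" using Z(2) not_tuned by blast
    \<comment> \<open>Every point outside \<open>Z\<close> and \<open>L\<close> sees
      \<open>L\<close>, so an empty \<open>L\<close> would force \<open>X = Z\<close>.\<close>
    then have "L \<noteq> {}" using L(3) Z(1) by blast
    then have "Z \<subset> Z \<union> L" "(Z \<union> L) - Z = L" using L(1) by auto
    then show ?thesis using L Z by (intro exI[of _ "Z \<union> L"]) (auto simp: good_def)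
  qed
  obtain Z where Z: "\<And>n :: nat. good (Z n)"
      "\<And>n. Z n \<subset> Z (Suc n) \<and> X - Z (Suc n) \<subseteq> R\<inverse> `` (Z (Suc n) - Z n)"
    using dependent_nat_choice[of "\<lambda>_. good" "\<lambda>_ Z Z'. Z \<subset> Z' \<and> X - Z' \<subseteq> R\<inverse> `` (Z' - Z)"]
      good_empty step by metis
  define T where "T n = Z (Suc n) - Z n" for n
  have ZX: "Z n \<subseteq> X" and Zc: "R `` Z n \<subseteq> Z n" for n using Z(1)[of n] by (auto simp: good_def tuned_def)
  have "Z n \<subseteq> Z (Suc n)" for n using Z(2)[of n] by blast
  then have mono: "Z m \<subseteq> Z n" if "m \<le> n" for m n
    using that by (rule lift_Suc_mono_le)
  have "T n \<subseteq> X" for n using ZX by (auto simp: T_def)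
  then have TV: "T n \<in> V" "D (T n) = R\<inverse> `` T n" for n
    using V by (simp_all add: complex_algebra_of_def frame_diamond_def)
  have disj: "T m \<inter> T n = {}" if "m < n" for m n
    using mono[of "Suc m" n] that by (auto simp: T_def)
  have "disjoint_family_on T {1..}"
    unfolding disjoint_family_on_def by (metis disj inf_commute linorder_neqE_nat)
  \<comment> \<open>In order: points outside \<open>Z (Suc n)\<close> see \<open>T n\<close>; the
    closed set \<open>Z (Suc n)\<close> contains \<open>T n\<close> but misses
    \<open>T (n + 1)\<close>; the chain is strict.\<close>
  moreover have "T (n + 1) \<subseteq> D (T n)" "T n \<inter> D (T (n + 1)) = {}" "T n \<noteq> {}" for n
    unfolding TV using Z(2)[of n] Zc[of "Suc n"] ZX[of "Suc (Suc n)"] by (auto simp: T_def)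
  ultimately show False using no TV(1) unfolding has_infinite_descending_tower_def by blast
qed

lemma tuned_finite_hull:
  assumes R: "R \<subseteq> X \<times> X" and V: "complex_algebra_of X R V D" and G: "G \<subseteq> V"
    and f: "tuned R G X f"
  shows "finite (modal_subalgebra X V D hull G)"
proof -
  define B where "B = {U. U \<subseteq> X \<and> (\<forall>x\<in>X. \<forall>y\<in>X. f x = f y \<longrightarrow> x \<in> U \<longrightarrow> y \<in> U)}"
  have "D U \<in> B" if U: "U \<in> B" for U
  proof -
    have DU: "D U = R\<inverse> `` U"
      using V U by (auto simp: complex_algebra_of_def frame_diamond_def B_def)
    have "y \<in> D U" if xy: "x \<in> X" "y \<in> X" "f x = f y" and x: "x \<in> D U" for x y
    proof -
      obtain u where u: "u \<in> U" "(x, u) \<in> R" using x DU by auto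
      \<comment> \<open>Stability transfers the colour of a witness \<open>u\<close> seen by
        \<open>x\<close> to some \<open>v\<close> seen by \<open>y\<close>; saturation puts
        \<open>v\<close> into \<open>U\<close>.\<close>
      have "f u \<in> f ` (R `` {x})" using u by blast
      also have "\<dots> = f ` (R `` {y})" by (rule tunedD(4)[OF f xy])
      finally obtain v where v: "(y, v) \<in> R" "f u = f v" by auto
      then have "v \<in> U" using u R U unfolding B_def by blast
      then show ?thesis using v DU by auto
    qed
    moreover have "D U \<subseteq> X" using DU R by auto
    ultimately show ?thesis unfolding B_def by blast
  qed
  moreover have "algebra X B"
  proof -
    have "X - U \<in> B" if "U \<in> B" for U
    proof -
      have "y \<notin> U" if "x \<in> X" "y \<in> X" "f x = f y" "x \<notin> U" for x y
        using \<open>U \<in> B\<close> that(1,2,4) that(3)[symmetric] unfolding B_def by blast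
      then show ?thesis unfolding B_def by blast
    qed
    moreover have "U \<union> W \<in> B" if "U \<in> B" "W \<in> B" for U W
      using that unfolding B_def by blast
    moreover have "B \<subseteq> Pow X" "{} \<in> B" unfolding B_def by blast+
    ultimately show ?thesis unfolding algebra_iff_Un by blast
  qed
  moreover have "B \<subseteq> V" using V by (auto simp: complex_algebra_of_def B_def)
  ultimately have "modal_subalgebra X V D B" by (simp add: modal_subalgebra_def)
  moreover have "G \<subseteq> B"
  proof
    fix U assume U: "U \<in> G"
    have "{W\<in>G. x \<in> W} = {W\<in>G. y \<in> W}" if "x \<in> X" "y \<in> X" "f x = f y" for x y
      by (rule tunedD(3)[OF f that])
    then show "U \<in> B" using U G V unfolding B_def complex_algebra_of_def by blast
  qed
  ultimately have sub: "modal_subalgebra X V D hull G \<subseteq> B" by (intro hull_minimal)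
  have "inj_on ((`) f) B"
  proof (rule inj_onI)
    have sub: "U \<subseteq> W" if "U \<in> B" "W \<in> B" "f ` U = f ` W" for U W
    proof
      fix x assume x: "x \<in> U"
      then have "f x \<in> f ` W" using that(3) by blast
      then obtain y where "y \<in> W" "f y = f x" by auto
      then show "x \<in> W" using that(1,2) x unfolding B_def by blast
    qed
    fix U W assume "U \<in> B" "W \<in> B" "f ` U = f ` W"
    then show "U = W" by (intro subset_antisym sub) simp_all
  qed
  moreover have "(`) f ` B \<subseteq> Pow (f ` X)" by (auto simp: B_def)
  moreover have "finite (Pow (f ` X))" using tunedD(2)[OF f] by simp
  ultimately have "finite B" using inj_on_finite by blast
  then show ?thesis using sub finite_subset by blast
qed

section \<open>From a tower to an infinite two-generated subalgebra\<close>

lemma tower_not_locally_finite: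
  fixes X :: "'a set"
  assumes R: "R \<subseteq> X \<times> X" "trans R" and V: "complex_algebra_of X R V D"
    and tower: "has_infinite_descending_tower V D"
  shows "\<not> locally_finite_algebra X V D"
proof
  assume lf: "locally_finite_algebra X V D"
  obtain S :: "nat \<Rightarrow> 'a set" where S: "\<forall>i\<ge>1. S i \<in> V \<and> S i \<noteq> {}" "disjoint_family_on S {1..}"
      "\<forall>i\<ge>1. S (i + 1) \<subseteq> D (S i) \<and> S i \<inter> D (S (i + 1)) = {}"
    using tower unfolding has_infinite_descending_tower_def by (elim exE conjE) (rule that)
  \<comment> \<open>The shift makes the levels start at 0.\<close>
  define T where "T n = S (Suc n)" for n
  have TV: "T n \<in> V" "T n \<noteq> {}" for n using S(1) by (auto simp: T_def)
  have VX: "V = Pow X" and DV: "\<And>U. U \<subseteq> X \<Longrightarrow> D U = R\<inverse> `` U"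
    using V by (auto simp: complex_algebra_of_def frame_diamond_def)
  have disj: "m = n" if "x \<in> T m" "x \<in> T n" for x m n
    using disjoint_family_onD[OF S(2), of "Suc m" "Suc n"] that by (auto simp: T_def)
  have down: "\<exists>y\<in>T m. (x, y) \<in> R" if "x \<in> T n" "m < n" for x m n
    using that(2,1)
  proof (induction arbitrary: x rule: strict_inc_induct[of m n, consumes 1])
    case (base i)
    then show ?case using S(3)[rule_format, of "Suc i"] DV TV(1)[of i] VX by (auto simp: T_def)
  next
    case (step i)
    then obtain y where y: "y \<in> T (Suc i)" "(x, y) \<in> R" by blast
    then obtain z where "z \<in> T i" "(y, z) \<in> R"
      using S(3)[rule_format, of "Suc i"] DV TV(1)[of i] VX by (auto simp: T_def)
    then show ?case using y R(2) by (blast dest: transD)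
  qed
  \<comment> \<open>If \<open>x\<close> in \<open>T m\<close> saw a higher level,
    \<open>down\<close> and transitivity would make it see \<open>T (Suc m)\<close>, which the tower
    forbids.\<close>
  have up: "(x, y) \<notin> R" if "x \<in> T m" "y \<in> T n" "m < n" for x y m n
  proof
    assume xy: "(x, y) \<in> R"
    have "\<exists>z\<in>T (Suc m). (x, z) \<in> R"
    proof (cases "n = Suc m")
      case False
      then show ?thesis using down[OF that(2), of "Suc m"] that(3) xy R(2) by (metis Suc_lessI transD)
    qed (use xy that in auto)
    then show False using S(3)[rule_format, of "Suc m"] DV TV(1)[of "Suc m"] VX that(1) by (auto simp: T_def)
  qed
  define P where "P b = (\<Union>n\<in>{n. even n = b}. T n)" for b
  define H where "H = modal_subalgebra X V D hull {P True, P False}"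
  have PV: "{P True, P False} \<subseteq> V" using TV(1) VX by (auto simp: P_def)
  have "modal_subalgebra X V D H"
    unfolding H_def by (rule modal_subalgebra_hull[OF modal_subalgebra_self[OF R(1) V] PV])
  then interpret algebra X H + H: ring_of_sets X H
    by (auto simp: modal_subalgebra_def algebra_def)
  have HD: "D U \<in> H" if "U \<in> H" for U
    using \<open>modal_subalgebra X V D H\<close> that by (simp add: modal_subalgebra_def)
  have PH: "P b \<in> H" for b using hull_subset[of "{P True, P False}"] by (cases b) (auto simp: H_def)
  have TH: "T n \<in> H" for n
  \<comment> \<open>Strong induction: the levels below \<open>n\<close> are already in
    \<open>H\<close>, so removing them stays in \<open>H\<close>.\<close>
  proof (induction n rule: less_induct)
    case (less n)
    define Q where "Q b = P b - (\<Union>j<n. T j)" for b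
    have QH: "Q b \<in> H" for b unfolding Q_def using less PH by (intro Diff finite_UN) auto
    have DQ: "D (Q b) = R\<inverse> `` Q b" for b using QH[of b] sets_into_space by (intro DV) auto
    have Q: "x \<in> Q b \<longleftrightarrow> (\<exists>k\<ge>n. even k = b \<and> x \<in> T k)" for x b
    proof
      assume "x \<in> Q b"
      then obtain k where "even k = b" "x \<in> T k" "\<not> k < n" unfolding Q_def P_def by blast
      then show "\<exists>k\<ge>n. even k = b \<and> x \<in> T k" by (auto simp: not_less)
    next
      assume "\<exists>k\<ge>n. even k = b \<and> x \<in> T k"
      then obtain k where k: "k \<ge> n" "even k = b" "x \<in> T k" by blast
      then have "x \<notin> T j" if "j < n" for j using disj[of x j k] that by auto
      then show "x \<in> Q b" using k unfolding Q_def P_def by blast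
    qed
    \<comment> \<open>By \<open>up\<close>, level \<open>n\<close> sees nothing above it. A higher
      level of the same parity is at least \<open>n + 2\<close>, so by \<open>down\<close> its
      points see \<open>T (Suc n)\<close>, which lies in \<open>Q (odd n)\<close>.\<close>
    have "T n = Q (even n) - D (Q (odd n))"
    proof (intro equalityI subsetI)
      fix x assume x: "x \<in> T n"
      have "(x, y) \<notin> R" if "y \<in> Q (odd n)" for y
      proof -
        obtain k where "k \<ge> n" "even k = odd n" "y \<in> T k" using \<open>y \<in> Q (odd n)\<close> unfolding Q by blast
        then show ?thesis using up[OF x] by (metis le_neq_implies_less)
      qed
      then show "x \<in> Q (even n) - D (Q (odd n))" using x DQ Q by auto
    next
      fix x assume x: "x \<in> Q (even n) - D (Q (odd n))"
      then obtain k where k: "k \<ge> n" "even k = even n" "x \<in> T k" unfolding Diff_iff Q by blast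
      have "\<not> n < k"
      proof
        assume "n < k"
        then have "Suc n < k" using k(2) by (metis Suc_lessI even_Suc)
        then obtain y where "y \<in> T (Suc n)" "(x, y) \<in> R" using down k(3) by blast
        moreover have "y \<in> Q (odd n)" unfolding Q using \<open>y \<in> T (Suc n)\<close> by (intro exI[of _ "Suc n"]) simp
        ultimately show False using x DQ by blast
      qed
      then show "x \<in> T n" using k by simp
    qed
    then show ?case using QH HD by (metis Diff)
  qed
  have "finitely_generated_subalgebra X V D H"
    unfolding finitely_generated_subalgebra_def using PV
    by (intro exI[of _ "{P True, P False}"]) (simp add: H_def)
  then have "finite H" using lf by (simp add: locally_finite_algebra_def)
  \<comment> \<open>Nonempty disjoint levels are distinct, so \<open>H\<close> has infinitely many
    elements.\<close>
  moreover have "inj T" using TV(2) disj by (intro injI) (metis all_not_in_conv)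
  ultimately show False using TH by (meson finite_subset image_subsetI infinite_UNIV_nat finite_imageD)
qed

theorem mainTheorem2:
  fixes X :: "'a set" and V :: "'a set set" and D :: "'a set \<Rightarrow> 'a set"
  assumes "complex_K4_algebra X V D"
  shows "locally_finite_algebra X V D \<longleftrightarrow> \<not> has_infinite_descending_tower V D"
proof -
  obtain R where R: "R \<subseteq> X \<times> X" "trans R" "complex_algebra_of X R V D"
    using assms complex_K4_algebra_iff_trans by blast
  have "locally_finite_algebra X V D" if no: "\<not> has_infinite_descending_tower V D"
    unfolding locally_finite_algebra_def finitely_generated_subalgebra_def
  proof (intro allI impI, elim exE conjE)
    fix A G assume G: "finite G" "G \<subseteq> V" and A: "A = modal_subalgebra X V D hull G"
    obtain f :: "'a \<Rightarrow> nat" where "tuned R G X f"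
      using no_tower_imp_tuned[OF R G(1) no] by blast
    then show "finite A" unfolding A by (rule tuned_finite_hull[OF R(1,3) G(2)])
  qed
  then show ?thesis using tower_not_locally_finite[OF R] by blast
qed

end
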